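(* Let $T\ge1$, let $H\in\mathbb{R}^{n_x\times n_x}$ be full rank, and let $\eta_k=\{E,F,K,L,C,D,\Sigma_v,P\}\in\Theta(H)$. Let $u_{1:T}$, $y_{1:T}$, $\xi_1\in\mathbb{R}^{n_x}$ and $w_{1:T}$ be arbitrary. Let $\gamma_k$ be the explicit model with $A=E^{-1}F$, $B=E^{-1}K$, $G=E^{-1}L$ and the same $C,D,\Sigma_v$. Put $\Lambda=I_T\otimes H$, let $$\Psi=\bar C'\Sigma_Y^{-1}\bar C-\Lambda'\bar F-\bar F'\Lambda,\qquad h=(\bar F')^{-1}\big(\Psi X^*-\bar C'\Sigma_Y^{-1}(Y-\bar DU)+\Lambda'\epsilon\big),$$ where $\bar F,\epsilon,\bar C,\bar D,\Sigma_Y$ are formed from $\eta_k$ and $X^*=\mathrm{vec}(x^*_{1:T})$ with $x_1^*=\xi_1$, $x^*_{t+1}=Ax^*_t+Bu_t+Gw_t$, and let $\lambda=2(\Lambda\,\mathrm{vec}(x_{1:T})+h)$. Then $$\bar J_\lambda(\eta_k)=\mathcal{E}(\gamma_k),$$ i.e. the convex bound $\bar J_\lambda(\eta)$ is tight to the simulation error at $\eta=\eta_k$.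
   Context: Notation: $|v|_Q^2=v'Qv$; $\mathbb{S}^n_{++}$ is the set of symmetric positive definite $n\times n$ matrices; $\mathrm{vec}$ stacks columns; $\otimes$ is the Kronecker product; $x_t\in\mathbb{R}^{n_x}$, $u_t\in\mathbb{R}^{n_u}$, $y_t\in\mathbb{R}^{n_y}$, $w_t\in\mathbb{R}^{n_w}$. Implicit model: $\eta=\{E,F,K,L,C,D,\Sigma_v,P\}$, with $\Sigma_v\in\mathbb{S}^{n_y}_{++}$, $P\in\mathbb{S}^{n_x}_{++}$, represents $Ex_{t+1}=Fx_t+Ku_t+Lw_t$, $y_t=Cx_t+Du_t+v_t$. $\Theta(H)$ is the set of $\eta$ satisfying $$\begin{bmatrix}H'E+E'H-P & F'H & C'\\ H'F & P & 0\\ C&0&\Sigma_v\end{bmatrix}\succ0 .$$ (This implies $H'E+E'H\succ0$, hence $E$ is invertible.) Dynamics constraint: $\mathcal{F}(\eta,u_{1:T},\xi_1,x_{1:T},w_{1:T})=\bar F\,\mathrm{vec}(x_{1:T})-\epsilon$, where $\bar F\in\mathbb{R}^{Tn_x\times Tn_x}$ is block lower bidiagonal with $E$ in every diagonal block and $-F$ in every block directly below the diagonal, and $\epsilon\in\mathbb{R}^{Tn_x}$ is the stacked vector with blocks $E\xi_1,\ Ku_1+Lw_1,\ \dots,\ Ku_{T-1}+Lw_{T-1}$. Lifted quantities: $Y=\mathrm{vec}(y_{1:T})$, $U=\mathrm{vec}(u_{1:T})$, $\bar C=I_T\otimes C$, $\bar D=I_T\otimes D$, $\Sigma_Y=I_T\otimes\Sigma_v$.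 Lagrangian relaxation: $\bar J_\lambda(\eta)=\sup_{x_{1:T}}\{\sum_{t=1}^T|y_t-Cx_t-Du_t|^2_{\Sigma_v^{-1}}-\lambda'\mathcal{F}(\eta,u_{1:T},\xi_1,x_{1:T},w_{1:T})\}$, where $\lambda$, being a function of $x_{1:T}$, is evaluated at the same $x_{1:T}$ over which the supremum is taken. Simulation error: $\mathcal{E}(\gamma)=\sum_{t=1}^T|y_t-Cx_t-Du_t|^2_{\Sigma_v^{-1}}$ where $x_1=\xi_1$ and $x_{t+1}=Ax_t+Bu_t+Gw_t$. *)

theory Defs
  imports
    "Jordan_Normal_Form.Gauss_Jordan_Elimination"
    "Jordan_Normal_Form.DL_Rank"
    "HOL-Library.Extended_Real"
begin

text \<open>A signal \<open>x\<^sub>1, \<dots>, x\<^sub>T\<close> is a function on the naturals of which only the values at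
  \<open>1, \<dots>, T\<close> matter. Matrix and vector entries, as usual, are indexed from 0.\<close>

type_synonym signal = "nat \<Rightarrow> real vec"

definition is_signal :: "nat \<Rightarrow> nat \<Rightarrow> signal \<Rightarrow> bool" where
  "is_signal T n x \<longleftrightarrow> (\<forall>t\<in>{1..T}. x t \<in> carrier_vec n)"

text \<open>\<open>vec(x\<^sub>1\<^sub>:\<^sub>T)\<close>, for a signal of vectors of dimension \<open>n\<close>.\<close>

definition stack :: "nat \<Rightarrow> nat \<Rightarrow> signal \<Rightarrow> real vec" where
  "stack T n x = vec (T * n) (\<lambda>i. x (i div n + 1) $ (i mod n))"

definition kronecker :: "real mat \<Rightarrow> real mat \<Rightarrow> real mat" (infixl \<open>\<otimes>\<^sub>K\<close> 70) where
  "A \<otimes>\<^sub>K B = mat (dim_row A * dim_row B) (dim_col A * dim_col B)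
     (\<lambda>(i, j). A $$ (i div dim_row B, j div dim_col B) * B $$ (i mod dim_row B, j mod dim_col B))"

text \<open>Unspecified when \<open>A\<close> is singular.\<close>

definition mat_inv :: "real mat \<Rightarrow> real mat" where
  "mat_inv A = the (mat_inverse A)"

definition append_cols :: "real mat \<Rightarrow> real mat \<Rightarrow> real mat" (infixr \<open>@\<^sub>c\<close> 66) where
  "A @\<^sub>c B = four_block_mat A B (0\<^sub>m 0 (dim_col A)) (0\<^sub>m 0 (dim_col B))"

definition pos_def :: "nat \<Rightarrow> real mat \<Rightarrow> bool" where
  "pos_def n M \<longleftrightarrow> M \<in> carrier_mat n n \<and> M\<^sup>T = M \<and>
     (\<forall>v\<in>carrier_vec n. v \<noteq> 0\<^sub>v n \<longrightarrow> v \<bullet> (M *\<^sub>v v) > 0)"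

definition wnorm2 :: "real mat \<Rightarrow> real vec \<Rightarrow> real" where
  "wnorm2 Q v = v \<bullet> (Q *\<^sub>v v)"

record implicit_model =
  iE :: "real mat"
  iF :: "real mat"
  iK :: "real mat"
  iL :: "real mat"
  iC :: "real mat"
  iD :: "real mat"
  iSigma :: "real mat"
  iP :: "real mat"

record explicit_model =
  eA :: "real mat"
  eB :: "real mat"
  eG :: "real mat"
  eC :: "real mat"
  eD :: "real mat"
  eSigma :: "real mat"

definition implicit_models :: "nat \<Rightarrow> nat \<Rightarrow> nat \<Rightarrow> nat \<Rightarrow> implicit_model set" where
  "implicit_models nx nu ny nw = {\<eta>.
     iE \<eta> \<in> carrier_mat nx nx \<and> iF \<eta> \<in> carrier_mat nx nx \<and>
     iK \<eta> \<in> carrier_mat nx nu \<and> iL \<eta> \<in> carrier_mat nx nw \<and>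
     iC \<eta> \<in> carrier_mat ny nx \<and> iD \<eta> \<in> carrier_mat ny nu \<and>
     pos_def ny (iSigma \<eta>) \<and> pos_def nx (iP \<eta>)}"

definition Theta :: "nat \<Rightarrow> nat \<Rightarrow> nat \<Rightarrow> nat \<Rightarrow> real mat \<Rightarrow> implicit_model set" where
  "Theta nx nu ny nw H = {\<eta> \<in> implicit_models nx nu ny nw.
     pos_def (nx + nx + ny)
       (   ((H\<^sup>T * iE \<eta> + (iE \<eta>)\<^sup>T * H - iP \<eta>) @\<^sub>c (iF \<eta>)\<^sup>T * H @\<^sub>c (iC \<eta>)\<^sup>T)
        @\<^sub>r (H\<^sup>T * iF \<eta> @\<^sub>c iP \<eta> @\<^sub>c 0\<^sub>m nx ny)
        @\<^sub>r (iC \<eta> @\<^sub>c 0\<^sub>m ny nx @\<^sub>c iSigma \<eta>))}"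

definition explicit_of :: "implicit_model \<Rightarrow> explicit_model" where
  "explicit_of \<eta> =
     \<lparr> eA = mat_inv (iE \<eta>) * iF \<eta>, eB = mat_inv (iE \<eta>) * iK \<eta>, eG = mat_inv (iE \<eta>) * iL \<eta>,
       eC = iC \<eta>, eD = iD \<eta>, eSigma = iSigma \<eta> \<rparr>"

text \<open>The state at time \<open>t \<ge> 1\<close>; the value at \<open>t = 0\<close> is never used.\<close>

fun sim :: "explicit_model \<Rightarrow> signal \<Rightarrow> signal \<Rightarrow> real vec \<Rightarrow> signal" where
  "sim \<gamma> u w \<xi> 0 = \<xi>"
| "sim \<gamma> u w \<xi> (Suc 0) = \<xi>"
| "sim \<gamma> u w \<xi> (Suc (Suc t)) =
     eA \<gamma> *\<^sub>v sim \<gamma> u w \<xi> (Suc t) + eB \<gamma> *\<^sub>v u (Suc t) + eG \<gamma> *\<^sub>v w (Suc t)"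

definition sim_error ::
  "nat \<Rightarrow> signal \<Rightarrow> signal \<Rightarrow> signal \<Rightarrow> real vec \<Rightarrow> explicit_model \<Rightarrow> real" where
  "sim_error T u y w \<xi> \<gamma> =
     (\<Sum>t = 1..T. wnorm2 (mat_inv (eSigma \<gamma>))
        (y t - eC \<gamma> *\<^sub>v sim \<gamma> u w \<xi> t - eD \<gamma> *\<^sub>v u t))"

definition Fbar :: "nat \<Rightarrow> nat \<Rightarrow> implicit_model \<Rightarrow> real mat" where
  "Fbar T nx \<eta> = mat (T * nx) (T * nx) (\<lambda>(i, j).
     if i div nx = j div nx then iE \<eta> $$ (i mod nx, j mod nx)
     else if i div nx = Suc (j div nx) then - (iF \<eta> $$ (i mod nx, j mod nx))
     else 0)"

definition eps ::
  "nat \<Rightarrow> nat \<Rightarrow> implicit_model \<Rightarrow> signal \<Rightarrow> signal \<Rightarrow> real vec \<Rightarrow> real vec" where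
  "eps T nx \<eta> u w \<xi> = stack T nx
     (\<lambda>t. if t = 1 then iE \<eta> *\<^sub>v \<xi> else iK \<eta> *\<^sub>v u (t - 1) + iL \<eta> *\<^sub>v w (t - 1))"

definition dyn_constraint ::
  "nat \<Rightarrow> nat \<Rightarrow> implicit_model \<Rightarrow> signal \<Rightarrow> real vec \<Rightarrow> signal \<Rightarrow> signal \<Rightarrow> real vec" where
  "dyn_constraint T nx \<eta> u \<xi> x w = Fbar T nx \<eta> *\<^sub>v stack T nx x - eps T nx \<eta> u w \<xi>"

text \<open>The multiplier \<open>mul\<close> is a function of the state signal. The supremum is taken in the
  extended reals, where it may a priori be infinite.\<close>

definition Jbar ::
  "nat \<Rightarrow> nat \<Rightarrow> signal \<Rightarrow> signal \<Rightarrow> signal \<Rightarrow> real vec \<Rightarrow> (signal \<Rightarrow> real vec)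
    \<Rightarrow> implicit_model \<Rightarrow> ereal" where
  "Jbar T nx u y w \<xi> mul \<eta> =
     (SUP x \<in> {x. is_signal T nx x}. ereal (
        (\<Sum>t = 1..T. wnorm2 (mat_inv (iSigma \<eta>)) (y t - iC \<eta> *\<^sub>v x t - iD \<eta> *\<^sub>v u t))
        - mul x \<bullet> dyn_constraint T nx \<eta> u \<xi> x w))"

end

theory Submission
  imports Defs
begin

text \<open>Since \<open>X\<^sup>*\<close> satisfies the dynamics and \<open>h\<close> is chosen such that the terms of the relaxed objective
  that are linear in \<open>\<delta> = X - X\<^sup>*\<close> cancel, the objective at \<open>X\<close> equals the simulation error plus
  \<open>\<delta>'\<Psi>\<delta>\<close>. The matrix inequality of \<open>\<Theta>\<close> is a dissipation inequality with storage function
  \<open>|\<delta>\<^sub>t|\<^sup>2\<close> weighted by \<open>P\<close>; summed over time it telescopes to \<open>\<delta>'\<Psi>\<delta> \<le> 0\<close>, so the supremum is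
  attained at \<open>X\<^sup>*\<close>.\<close>

text \<open>The two parts of the multiplier \<lambda> have separate tasks. The slope \<Lambda>
  shapes the quadratic part of the objective; since \<Lambda> is block diagonal and
  \<open>Fbar\<close> couples only neighbouring blocks, that part splits into one term per time
  step. The offset \<open>h\<close> solves a linear system whose matrix is \<open>Fbar\<close>
  transposed, so it has its intended meaning only if \<open>Fbar\<close> is nonsingular. This
  reduces to nonsingularity of \<open>E\<close>, which is a further consequence of the matrix
  inequality.

  The telescoping has a mismatch to overcome: the inequality joins the cost of a deviation to the
  coupling with its successor, whereas a block row of \<open>Fbar\<close> couples a state to its
  predecessor. The sequence of deviations is therefore continued by a zero state at both ends,
  before time 1 and after time \<open>T\<close>.\<close>

section \<open>Adjoints, inverses and positive definite matrices\<close>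

lemma inner_mat_vec_transpose:
  fixes A :: "real mat"
  assumes "A \<in> carrier_mat m n" "x \<in> carrier_vec n" "y \<in> carrier_vec m"
  shows "x \<bullet> (A\<^sup>T *\<^sub>v y) = (A *\<^sub>v x) \<bullet> y"
proof -
  have "x \<bullet> (A\<^sup>T *\<^sub>v y) = (A\<^sup>T *\<^sub>v y) \<bullet> x"
    using assms by (intro comm_scalar_prod[of _ n]) auto
  also have "\<dots> = y \<bullet> (A *\<^sub>v x)"
    using assms by (intro transpose_vec_mult_scalar) auto
  also have "\<dots> = (A *\<^sub>v x) \<bullet> y"
    using assms by (intro comm_scalar_prod[of _ m]) auto
  finally show ?thesis .
qed

text \<open>\<open>mat_inv\<close> is unspecified on singular matrices, so each use requires
  nonsingularity. A trivial kernel is the convenient criterion: definiteness and forward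
  substitution both deliver it directly.\<close>

lemma mat_inv_inverts:
  assumes A: "A \<in> carrier_mat n n"
    and inj: "\<And>v. v \<in> carrier_vec n \<Longrightarrow> A *\<^sub>v v = 0\<^sub>v n \<Longrightarrow> v = 0\<^sub>v n"
  shows "mat_inv A \<in> carrier_mat n n" "A * mat_inv A = 1\<^sub>m n" "mat_inv A * A = 1\<^sub>m n"
proof -
  have "det A \<noteq> 0"
    using inj det_0_iff_vec_prod_zero[OF A] by blast
  then have "A \<in> Units (ring_mat TYPE(real) n ())"
    by (rule det_non_zero_imp_unit[OF A])
  then obtain B where "mat_inverse A = Some B"
    using mat_inverse(1)[OF A, where b = "()"] by (cases "mat_inverse A") auto
  then show "mat_inv A \<in> carrier_mat n n" "A * mat_inv A = 1\<^sub>m n" "mat_inv A * A = 1\<^sub>m n"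
    using mat_inverse(2)[OF A] by (auto simp: mat_inv_def)
qed

text \<open>A left inverse already forces a trivial kernel, and then associativity identifies it
  with \<open>mat_inv A\<close>.\<close>

lemma mat_inv_eqI:
  assumes A: "A \<in> carrier_mat n n" and B: "B \<in> carrier_mat n n" and BA: "B * A = 1\<^sub>m n"
  shows "mat_inv A = B"
proof -
  have inj: "v = 0\<^sub>v n" if v: "v \<in> carrier_vec n" "A *\<^sub>v v = 0\<^sub>v n" for v
  proof -
    have "v = (B * A) *\<^sub>v v" using v BA by simp
    also have "\<dots> = B *\<^sub>v (A *\<^sub>v v)" using A B v by (intro assoc_mult_mat_vec) auto
    also have "\<dots> = 0\<^sub>v n" using v B by (auto intro!: eq_vecI simp: scalar_prod_def)
    finally show ?thesis .
  qed
  note inv = mat_inv_inverts[OF A inj]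
  have "mat_inv A = (B * A) * mat_inv A" using BA inv by simp
  also have "\<dots> = B * (A * mat_inv A)" using A B inv(1) by (intro assoc_mult_mat) auto
  finally show ?thesis using B inv(2) by simp
qed

lemma pos_def_kernel:
  assumes "pos_def n M" "v \<in> carrier_vec n" "M *\<^sub>v v = 0\<^sub>v n"
  shows "v = 0\<^sub>v n"
  using assms by (auto simp: pos_def_def)

lemma pos_def_nonneg:
  assumes "pos_def n M" "v \<in> carrier_vec n"
  shows "v \<bullet> (M *\<^sub>v v) \<ge> 0"
  using assms by (cases "v = 0\<^sub>v n") (auto simp: pos_def_def less_imp_le)

text \<open>Transposing \<open>M * mat_inv M = 1\<close> exhibits the transposed inverse as a left
  inverse of the symmetric \<open>M\<close>. The symmetry is what merges the two cross terms of a
  weighted square.\<close>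

lemma pos_def_mat_inv_sym:
  assumes M: "pos_def n M"
  shows "(mat_inv M)\<^sup>T = mat_inv M"
proof -
  have Mc: "M \<in> carrier_mat n n" and Ms: "M\<^sup>T = M" using M by (auto simp: pos_def_def)
  note inv = mat_inv_inverts[OF Mc pos_def_kernel[OF M]]
  have "(mat_inv M)\<^sup>T * M = (M * mat_inv M)\<^sup>T"
    using transpose_mult[OF Mc inv(1)] Ms by simp
  then have "(mat_inv M)\<^sup>T * M = 1\<^sub>m n" using inv(2) by simp
  then show ?thesis
    using mat_inv_eqI[OF Mc, of "(mat_inv M)\<^sup>T"] inv(1) by simp
qed

section \<open>Stacked signals\<close>

lemma stack_carrier [simp]: "stack T n x \<in> carrier_vec (T * n)"
  by (simp add: stack_def)

lemma is_signalD: "is_signal T n x \<Longrightarrow> t \<in> {1..T} \<Longrightarrow> x t \<in> carrier_vec n"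
  by (simp add: is_signal_def)

lemma stack_index:
  assumes "t < T" "k < n"
  shows "stack T n x $ (t * n + k) = x (Suc t) $ k"
proof -
  have "t * n + k < Suc t * n" using assms by simp
  also have "\<dots> \<le> T * n" using assms by (intro mult_right_mono) auto
  finally show ?thesis using assms by (simp add: stack_def)
qed

lemma stack_cong:
  assumes "\<And>t. t \<in> {1..T} \<Longrightarrow> x t = z t"
  shows "stack T n x = stack T n z"
  unfolding stack_def
proof (rule eq_vecI, goal_cases)
  case (1 i)
  then have "i div n < T" by (simp add: less_mult_imp_div_less)
  then show ?case using 1 assms[of "i div n + 1"] by simp
qed simp

text \<open>Lets a statement about arbitrary vectors of length \<open>T * n\<close> be proved block
  by block.\<close>

lemma exists_signal_stack:
  assumes v: "v \<in> carrier_vec (T * n)"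
  obtains x where "is_signal T n x" "stack T n x = v"
proof
  let ?x = "\<lambda>t. vec n (\<lambda>k. v $ ((t - 1) * n + k))"
  show "is_signal T n ?x" by (simp add: is_signal_def)
  show "stack T n ?x = v"
  proof (rule eq_vecI)
    fix i assume "i < dim_vec v"
    with v have i: "i < T * n" by auto
    \<comment> \<open>An index exists only if blocks are nonempty; positivity lets div and mod
      recover it from block and offset.\<close>
    then have "n > 0" by (cases n) auto
    then show "stack T n ?x $ i = v $ i" using i by (simp add: stack_def)
  qed (use v in \<open>simp add: stack_def\<close>)
qed

lemma sum_blocks:
  fixes g :: "nat \<Rightarrow> real"
  shows "(\<Sum>i<T * n. g i) = (\<Sum>t<T. \<Sum>k<n. g (t * n + k))"
proof -
  have "(\<Sum>i<T * n. g i) = (\<Sum>t<T. sum g {t * n..<t * n + n})"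
    by (rule sum.nat_group[symmetric])
  also have "\<dots> = (\<Sum>t<T. \<Sum>k<n. g (t * n + k))"
  proof (rule sum.cong, goal_cases)
    case (2 t)
    show ?case
      using sum.shift_bounds_nat_ivl[of g 0 "t * n" n]
      by (simp add: lessThan_atLeast0 add.commute)
  qed simp
  finally show ?thesis .
qed

text \<open>The hypothesis fixes the block length of the second factor because a scalar product sums
  over the dimension of its second argument.\<close>

lemma stack_inner:
  assumes "is_signal T n z"
  shows "stack T n x \<bullet> stack T n z = (\<Sum>t = 1..T. x t \<bullet> z t)"
proof -
  have "stack T n x \<bullet> stack T n z = (\<Sum>i<T * n. stack T n x $ i * stack T n z $ i)"
    by (simp add: scalar_prod_def lessThan_atLeast0 stack_def)
  also have "\<dots> = (\<Sum>t<T. \<Sum>k<n. x (Suc t) $ k * z (Suc t) $ k)"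
    by (simp add: sum_blocks stack_index)
  also have "\<dots> = (\<Sum>t<T. x (Suc t) \<bullet> z (Suc t))"
  proof (rule sum.cong, goal_cases)
    case (2 t)
    then have "z (Suc t) \<in> carrier_vec n" using assms by (auto intro: is_signalD)
    then show ?case by (auto simp: scalar_prod_def lessThan_atLeast0)
  qed simp
  also have "\<dots> = (\<Sum>t = 1..T. x t \<bullet> z t)"
    by (rule sum.reindex_bij_witness[of _ "\<lambda>t. t - 1" Suc]) auto
  finally show ?thesis .
qed

lemma stack_minus:
  assumes "is_signal T n x" "is_signal T n z"
  shows "stack T n x - stack T n z = stack T n (\<lambda>t. x t - z t)"
proof (rule eq_vecI, goal_cases)
  case (1 i)
  then have i: "i < T * n" by (simp add: stack_def)
  then have n: "n > 0" by (cases n) auto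
  have "i div n < T" using i by (simp add: less_mult_imp_div_less)
  then have "z (Suc (i div n)) \<in> carrier_vec n" "x (Suc (i div n)) \<in> carrier_vec n"
    using assms by (auto intro: is_signalD)
  then show ?case using i n by (auto simp: stack_def)
qed (simp add: stack_def)

section \<open>Block matrices acting on stacked signals\<close>

lemma kronecker_carrier:
  "A \<in> carrier_mat p q \<Longrightarrow> B \<in> carrier_mat m n \<Longrightarrow> A \<otimes>\<^sub>K B \<in> carrier_mat (p * m) (q * n)"
  by (auto simp: kronecker_def)

lemma kronecker_transpose: "(A \<otimes>\<^sub>K B)\<^sup>T = A\<^sup>T \<otimes>\<^sub>K B\<^sup>T"
proof (rule eq_matI, goal_cases)
  case (1 i j)
  then have i: "i < dim_col A * dim_col B" and j: "j < dim_row A * dim_row B"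
    by (auto simp: kronecker_def)
  then have "dim_col B > 0" "dim_row B > 0" by (auto intro: gr0I)
  then show ?case using i j by (auto simp: kronecker_def less_mult_imp_div_less)
qed (auto simp: kronecker_def)

lemma block_diagonal_mult_stack:
  assumes M: "M \<in> carrier_mat m n" and x: "is_signal T n x"
  shows "(1\<^sub>m T \<otimes>\<^sub>K M) *\<^sub>v stack T n x = stack T m (\<lambda>t. M *\<^sub>v x t)"
proof (rule eq_vecI)
  have K: "1\<^sub>m T \<otimes>\<^sub>K M \<in> carrier_mat (T * m) (T * n)"
    using M by (intro kronecker_carrier) auto
  show "dim_vec ((1\<^sub>m T \<otimes>\<^sub>K M) *\<^sub>v stack T n x) = dim_vec (stack T m (\<lambda>t. M *\<^sub>v x t))"
    using K by (simp add: stack_def)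
  fix i assume "i < dim_vec (stack T m (\<lambda>t. M *\<^sub>v x t))"
  then have i: "i < T * m" by (simp add: stack_def)
  then have m: "m > 0" by (cases m) auto
  have it: "i div m < T" using i by (simp add: less_mult_imp_div_less)
  have xc: "x (Suc (i div m)) \<in> carrier_vec n" using x it by (auto intro: is_signalD)
  \<comment> \<open>Row \<open>i\<close> lies in block row \<open>i div m\<close>, whose only
    nonzero block is the diagonal one, so the double sum over blocks and offsets collapses to one
    block.\<close>
  have entry: "(1\<^sub>m T \<otimes>\<^sub>K M) $$ (i, t * n + k) = (if t = i div m then M $$ (i mod m, k) else 0)"
    if "t < T" "k < n" for t k
  proof -
    have "t * n + k < Suc t * n" using that by simp
    also have "\<dots> \<le> T * n" using that by (intro mult_right_mono) auto
    finally show ?thesis using i M that it by (auto simp: kronecker_def)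
  qed
  have "((1\<^sub>m T \<otimes>\<^sub>K M) *\<^sub>v stack T n x) $ i
      = (\<Sum>j<T * n. (1\<^sub>m T \<otimes>\<^sub>K M) $$ (i, j) * stack T n x $ j)"
    using K i by (simp add: scalar_prod_def lessThan_atLeast0 stack_def)
  also have "\<dots> = (\<Sum>t<T. if t = i div m then \<Sum>k<n. M $$ (i mod m, k) * x (Suc t) $ k else 0)"
    unfolding sum_blocks by (intro sum.cong refl) (auto simp: stack_index entry)
  also have "\<dots> = (\<Sum>k<n. M $$ (i mod m, k) * x (Suc (i div m)) $ k)"
    using it by simp
  also have "\<dots> = (M *\<^sub>v x (Suc (i div m))) $ (i mod m)"
    using M m xc by (auto simp: scalar_prod_def lessThan_atLeast0)
  finally show "((1\<^sub>m T \<otimes>\<^sub>K M) *\<^sub>v stack T n x) $ i = stack T m (\<lambda>t. M *\<^sub>v x t) $ i"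
    using i by (simp add: stack_def)
qed

lemma Fbar_mult_stack:
  assumes E: "iE \<eta> \<in> carrier_mat n n" and F: "iF \<eta> \<in> carrier_mat n n" and x: "is_signal T n x"
  shows "Fbar T n \<eta> *\<^sub>v stack T n x
    = stack T n (\<lambda>t. if t = 1 then iE \<eta> *\<^sub>v x 1 else iE \<eta> *\<^sub>v x t - iF \<eta> *\<^sub>v x (t - 1))"
    (is "_ = stack T n ?z")
proof (rule eq_vecI)
  show "dim_vec (Fbar T n \<eta> *\<^sub>v stack T n x) = dim_vec (stack T n ?z)"
    by (simp add: stack_def Fbar_def)
  fix i assume "i < dim_vec (stack T n ?z)"
  then have i: "i < T * n" by (simp add: stack_def)
  then have n: "n > 0" by (cases n) auto
  define s r where "s = i div n" and "r = i mod n"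
  have s: "s < T" using i by (simp add: s_def less_mult_imp_div_less)
  have r: "r < n" using n by (simp add: r_def)
  \<comment> \<open>The two conditions exclude each other, so the nested case distinction of
    \<open>Fbar\<close> is a difference of two indicator terms, and the row sum splits into a
    diagonal and a subdiagonal part.\<close>
  have entry: "Fbar T n \<eta> $$ (i, t * n + k) = (if t = s then iE \<eta> $$ (r, k) else 0)
      - (if Suc t = s then iF \<eta> $$ (r, k) else 0)"
    if "t < T" "k < n" for t k
  proof -
    have "t * n + k < Suc t * n" using that by simp
    also have "\<dots> \<le> T * n" using that by (intro mult_right_mono) auto
    finally show ?thesis using i that by (auto simp: Fbar_def s_def r_def)
  qed
  have row: "(\<Sum>k<n. M $$ (r, k) * x (Suc t) $ k) = (M *\<^sub>v x (Suc t)) $ r"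
    if "M \<in> carrier_mat n n" "t < T" for M t
  proof -
    have "x (Suc t) \<in> carrier_vec n" using x that by (auto intro: is_signalD)
    then show ?thesis using that r by (auto simp: scalar_prod_def lessThan_atLeast0)
  qed
  have "(Fbar T n \<eta> *\<^sub>v stack T n x) $ i = (\<Sum>j<T * n. Fbar T n \<eta> $$ (i, j) * stack T n x $ j)"
    using i by (simp add: Fbar_def scalar_prod_def lessThan_atLeast0 stack_def)
  also have "\<dots> = (\<Sum>t<T. if t = s then \<Sum>k<n. iE \<eta> $$ (r, k) * x (Suc t) $ k else 0)
      - (\<Sum>t<T. if Suc t = s then \<Sum>k<n. iF \<eta> $$ (r, k) * x (Suc t) $ k else 0)"
    unfolding sum_blocks sum_subtractf[symmetric]
    by (intro sum.cong refl) (auto simp: stack_index entry sum_negf)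
  also have "(\<Sum>t<T. if t = s then \<Sum>k<n. iE \<eta> $$ (r, k) * x (Suc t) $ k else 0)
      = (iE \<eta> *\<^sub>v x (Suc s)) $ r"
    using s row[OF E s] by simp
  \<comment> \<open>Block \<open>s\<close> holds the state at time \<open>Suc s\<close>, hence its
    predecessor is \<open>x s\<close>; block row 0 has no subdiagonal block.\<close>
  also have "(\<Sum>t<T. if Suc t = s then \<Sum>k<n. iF \<eta> $$ (r, k) * x (Suc t) $ k else 0)
      = (if s = 0 then 0 else (iF \<eta> *\<^sub>v x s) $ r)"
  proof (cases s)
    case (Suc p)
    then have "p < T" using s by simp
    then show ?thesis using Suc row[OF F, of p] by simp
  qed simp
  also have "(iE \<eta> *\<^sub>v x (Suc s)) $ r - (if s = 0 then 0 else (iF \<eta> *\<^sub>v x s) $ r) = ?z (Suc s) $ r"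
    using E F r by auto
  also have "\<dots> = stack T n ?z $ i"
    using i by (simp add: stack_def s_def r_def)
  finally show "(Fbar T n \<eta> *\<^sub>v stack T n x) $ i = stack T n ?z $ i" .
qed

lemma Fbar_carrier [simp]: "Fbar T n \<eta> \<in> carrier_mat (T * n) (T * n)"
  by (simp add: Fbar_def)

text \<open>The product of the two Kronecker matrices fixes every stacked signal, since
  \<open>B * M\<close> does so in each block. Evaluating it on unit vectors then shows that it is
  the identity.\<close>

lemma mat_inv_block_diagonal:
  assumes M: "M \<in> carrier_mat n n" "B \<in> carrier_mat n n" "B * M = 1\<^sub>m n"
  shows "mat_inv (1\<^sub>m T \<otimes>\<^sub>K M) = 1\<^sub>m T \<otimes>\<^sub>K B"
proof (rule mat_inv_eqI)
  show K: "1\<^sub>m T \<otimes>\<^sub>K M \<in> carrier_mat (T * n) (T * n)" "1\<^sub>m T \<otimes>\<^sub>K B \<in> carrier_mat (T * n) (T * n)"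
    using M by (auto intro: kronecker_carrier)
  have act: "((1\<^sub>m T \<otimes>\<^sub>K B) * (1\<^sub>m T \<otimes>\<^sub>K M)) *\<^sub>v v = v" if v: "v \<in> carrier_vec (T * n)" for v
  proof -
    obtain x where x: "is_signal T n x" and xv: "stack T n x = v"
      using exists_signal_stack[OF v] .
    have "((1\<^sub>m T \<otimes>\<^sub>K B) * (1\<^sub>m T \<otimes>\<^sub>K M)) *\<^sub>v v = (1\<^sub>m T \<otimes>\<^sub>K B) *\<^sub>v ((1\<^sub>m T \<otimes>\<^sub>K M) *\<^sub>v v)"
      using K v by (intro assoc_mult_mat_vec) auto
    also have "(1\<^sub>m T \<otimes>\<^sub>K M) *\<^sub>v v = stack T n (\<lambda>t. M *\<^sub>v x t)"
      using block_diagonal_mult_stack[OF M(1) x] xv by simp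
    also have "(1\<^sub>m T \<otimes>\<^sub>K B) *\<^sub>v \<dots> = stack T n (\<lambda>t. B *\<^sub>v (M *\<^sub>v x t))"
      using M x by (intro block_diagonal_mult_stack) (auto simp: is_signal_def)
    also have "\<dots> = stack T n x"
    proof (rule stack_cong)
      fix t assume "t \<in> {1..T}"
      then have "x t \<in> carrier_vec n" using x by (rule is_signalD[rotated])
      then show "B *\<^sub>v (M *\<^sub>v x t) = x t"
        using M by (simp flip: assoc_mult_mat_vec)
    qed
    finally show ?thesis using xv by simp
  qed
  define X where "X = (1\<^sub>m T \<otimes>\<^sub>K B) * (1\<^sub>m T \<otimes>\<^sub>K M)"
  have X: "X \<in> carrier_mat (T * n) (T * n)" using K by (auto simp: X_def)
  have "X = 1\<^sub>m (T * n)"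
  proof (rule eq_matI, goal_cases)
    case (1 i j)
    then have "X $$ (i, j) = (X *\<^sub>v unit_vec (T * n) j) $ i" using X by simp
    then show ?case using 1 act[of "unit_vec (T * n) j"] by (simp add: X_def unit_vec_def)
  qed (use X in auto)
  then show "(1\<^sub>m T \<otimes>\<^sub>K B) * (1\<^sub>m T \<otimes>\<^sub>K M) = 1\<^sub>m (T * n)" by (simp add: X_def)
qed

lemma append_cols_carrier:
  "A \<in> carrier_mat m p \<Longrightarrow> B \<in> carrier_mat m q \<Longrightarrow> A @\<^sub>c B \<in> carrier_mat m (p + q)"
  by (auto simp: append_cols_def)

lemma append_cols_mult_vec:
  assumes A: "A \<in> carrier_mat m p" and B: "B \<in> carrier_mat m q"
    and a: "a \<in> carrier_vec p" and b: "b \<in> carrier_vec q"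
  shows "(A @\<^sub>c B) *\<^sub>v (a @\<^sub>v b) = A *\<^sub>v a + B *\<^sub>v b"
proof -
  \<comment> \<open>The lower blocks in the encoding of \<open>@\<^sub>c\<close> have no rows, so
    the second component is the empty vector.\<close>
  have "(A @\<^sub>c B) *\<^sub>v (a @\<^sub>v b)
      = (A *\<^sub>v a + B *\<^sub>v b) @\<^sub>v (0\<^sub>m 0 p *\<^sub>v a + 0\<^sub>m 0 q *\<^sub>v b)"
    using assms four_block_mat_mult_vec[OF A B, of "0\<^sub>m 0 p" 0 "0\<^sub>m 0 q" a b]
    by (simp add: append_cols_def)
  then show ?thesis using A B by (auto intro!: eq_vecI)
qed

section \<open>Expansion of the relaxed objective about a feasible point\<close>

text \<open>The objective is quadratic in \<open>X\<close>, and \<open>Fh\<close> says precisely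
  that its gradient at \<open>X0\<close> vanishes. Feasibility \<open>e\<close> removes the
  multiplier term at \<open>X0\<close>, so only the value there and the second-order term in
  \<open>d\<close> survive.\<close>

lemma relaxed_objective_expansion:
  fixes C S F L :: "real mat"
  assumes C: "C \<in> carrier_mat m n" and S: "S \<in> carrier_mat m m" and S_sym: "S\<^sup>T = S"
    and F: "F \<in> carrier_mat n n" and L: "L \<in> carrier_mat n n"
    and R: "R \<in> carrier_vec m" and h: "h \<in> carrier_vec n"
    and X: "X \<in> carrier_vec n" and X0: "X0 \<in> carrier_vec n"
    and e: "F *\<^sub>v X0 = e"
    and Fh: "F\<^sup>T *\<^sub>v h = (C\<^sup>T * S * C - L\<^sup>T * F - F\<^sup>T * L) *\<^sub>v X0 - (C\<^sup>T * S) *\<^sub>v R + L\<^sup>T *\<^sub>v e"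
    and d: "d = X - X0"
  shows "wnorm2 S (R - C *\<^sub>v X) - (2 \<cdot>\<^sub>v (L *\<^sub>v X + h)) \<bullet> (F *\<^sub>v X - e)
    = wnorm2 S (R - C *\<^sub>v X0) + (wnorm2 S (C *\<^sub>v d) - 2 * ((L *\<^sub>v d) \<bullet> (F *\<^sub>v d)))"
proof -
  define a where "a = R - C *\<^sub>v X0"
  define c where "c = C *\<^sub>v d"
  have dc: "d \<in> carrier_vec n" using X X0 d by simp
  have ac: "a \<in> carrier_vec m" and cc: "c \<in> carrier_vec m"
    using R C X0 dc by (auto simp: a_def c_def)
  have Sv: "S *\<^sub>v v \<in> carrier_vec m" if "v \<in> carrier_vec m" for v using S that by simp
  have CX0: "C *\<^sub>v X0 \<in> carrier_vec m" using C X0 by simp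
  have LX0: "L *\<^sub>v X0 \<in> carrier_vec n" and FX0: "F *\<^sub>v X0 \<in> carrier_vec n"
    and Ld: "L *\<^sub>v d \<in> carrier_vec n" and Fd: "F *\<^sub>v d \<in> carrier_vec n"
    using L F X0 dc by auto
  have res: "R - C *\<^sub>v X = a - c"
    using C R X X0 mult_minus_distrib_mat_vec[OF C X X0]
    by (auto simp: a_def c_def d intro!: eq_vecI)
  have dyn: "F *\<^sub>v X - e = F *\<^sub>v d"
    using mult_minus_distrib_mat_vec[OF F X X0] by (simp add: d flip: e)
  have LX: "L *\<^sub>v X = L *\<^sub>v X0 + L *\<^sub>v d"
    using L X X0 mult_minus_distrib_mat_vec[OF L X X0] by (auto simp: d intro!: eq_vecI)
  have cross: "a \<bullet> (S *\<^sub>v c) = c \<bullet> (S *\<^sub>v a)"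
    using inner_mat_vec_transpose[OF S ac cc] S_sym comm_scalar_prod[OF Sv[OF ac] cc] by simp
  have quad: "wnorm2 S (a - c) = wnorm2 S a - 2 * (c \<bullet> (S *\<^sub>v a)) + wnorm2 S c"
    unfolding wnorm2_def mult_minus_distrib_mat_vec[OF S ac cc]
    using cross scalar_prod_minus_distrib[OF _ Sv[OF ac] Sv[OF cc]]
      minus_scalar_prod_distrib[OF ac cc, of "S *\<^sub>v a - S *\<^sub>v c"] ac cc Sv
    by simp
  have \<Psi>X0: "(C\<^sup>T * S * C - L\<^sup>T * F - F\<^sup>T * L) *\<^sub>v X0
      = C\<^sup>T *\<^sub>v (S *\<^sub>v (C *\<^sub>v X0)) - L\<^sup>T *\<^sub>v (F *\<^sub>v X0) - F\<^sup>T *\<^sub>v (L *\<^sub>v X0)"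
  proof -
    have "(C\<^sup>T * S * C - L\<^sup>T * F - F\<^sup>T * L) *\<^sub>v X0
        = (C\<^sup>T * S * C) *\<^sub>v X0 - (L\<^sup>T * F) *\<^sub>v X0 - (F\<^sup>T * L) *\<^sub>v X0"
      using C S L F X0
      by (subst minus_mult_distrib_mat_vec[of _ n n], auto)
         (subst minus_mult_distrib_mat_vec[of _ n n], auto)
    moreover have "(C\<^sup>T * S * C) *\<^sub>v X0 = C\<^sup>T *\<^sub>v (S *\<^sub>v (C *\<^sub>v X0))"
      using C S X0 by (simp add: assoc_mult_mat_vec[of _ n m _ n] assoc_mult_mat_vec[of _ n m _ m])
    moreover have "(L\<^sup>T * F) *\<^sub>v X0 = L\<^sup>T *\<^sub>v (F *\<^sub>v X0)" "(F\<^sup>T * L) *\<^sub>v X0 = F\<^sup>T *\<^sub>v (L *\<^sub>v X0)"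
      using L F X0 by auto
    ultimately show ?thesis by simp
  qed
  have CSR: "(C\<^sup>T * S) *\<^sub>v R = C\<^sup>T *\<^sub>v (S *\<^sub>v R)"
    using C S R by auto
  have tr: "C\<^sup>T *\<^sub>v v \<in> carrier_vec n" "F\<^sup>T *\<^sub>v v \<in> carrier_vec n" for v
    by (rule carrier_vecI; use C F in simp)+
  \<comment> \<open>Passing to the transpose brings in \<open>Fh\<close>. The two terms with the
    transpose of \<open>L\<close> cancel because \<open>e\<close> is \<open>F\<close> applied to
    \<open>X0\<close>; what remains offsets exactly the cross term of \<open>quad\<close> and the
    part of the multiplier coming from \<open>L\<close> at \<open>X0\<close>.\<close>
  have "h \<bullet> (F *\<^sub>v d) = d \<bullet> (F\<^sup>T *\<^sub>v h)"
    using inner_mat_vec_transpose[OF F dc h] comm_scalar_prod[OF Fd h] by simp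
  also have "F\<^sup>T *\<^sub>v h = C\<^sup>T *\<^sub>v (S *\<^sub>v (C *\<^sub>v X0)) - F\<^sup>T *\<^sub>v (L *\<^sub>v X0) - C\<^sup>T *\<^sub>v (S *\<^sub>v R)"
    unfolding Fh \<Psi>X0 CSR e[symmetric] using C F L by (auto intro!: eq_vecI)
  also have "d \<bullet> \<dots> = d \<bullet> (C\<^sup>T *\<^sub>v (S *\<^sub>v (C *\<^sub>v X0))) - d \<bullet> (F\<^sup>T *\<^sub>v (L *\<^sub>v X0)) - d \<bullet> (C\<^sup>T *\<^sub>v (S *\<^sub>v R))"
    using tr by (simp add: scalar_prod_minus_distrib[OF dc])
  also have "\<dots> = c \<bullet> (S *\<^sub>v (C *\<^sub>v X0)) - (F *\<^sub>v d) \<bullet> (L *\<^sub>v X0) - c \<bullet> (S *\<^sub>v R)"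
    using inner_mat_vec_transpose[OF C dc Sv[OF CX0]] inner_mat_vec_transpose[OF C dc Sv[OF R]]
      inner_mat_vec_transpose[OF F dc LX0] by (simp add: c_def)
  also have "\<dots> = - (c \<bullet> (S *\<^sub>v a)) - (L *\<^sub>v X0) \<bullet> (F *\<^sub>v d)"
    using mult_minus_distrib_mat_vec[OF S R CX0] scalar_prod_minus_distrib[OF cc Sv[OF R] Sv[OF CX0]]
      comm_scalar_prod[OF LX0 Fd] by (simp add: a_def)
  finally have hF: "h \<bullet> (F *\<^sub>v d) = - (c \<bullet> (S *\<^sub>v a)) - (L *\<^sub>v X0) \<bullet> (F *\<^sub>v d)" .
  have "(2 \<cdot>\<^sub>v (L *\<^sub>v X + h)) \<bullet> (F *\<^sub>v d)
      = 2 * ((L *\<^sub>v X0) \<bullet> (F *\<^sub>v d) + (L *\<^sub>v d) \<bullet> (F *\<^sub>v d) + h \<bullet> (F *\<^sub>v d))"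
    using LX0 Ld Fd h
    by (simp add: LX add_scalar_prod_distrib[of _ n] smult_scalar_prod_distrib[of _ n])
  then show ?thesis
    unfolding res dyn using quad hF by (simp add: a_def c_def)
qed

section \<open>The matrix inequality as a dissipation inequality\<close>

text \<open>\<open>Q\<close> is the quadratic form of the block matrix at the concatenation of
  \<open>a\<close>, \<open>b\<close> and \<open>c\<close>; the factors 2 come from its symmetric
  pairs of blocks. The strict version serves the nonsingularity of \<open>E\<close>, the weak one
  the dissipation estimate.\<close>

lemma Theta_quadratic_form:
  assumes H: "H \<in> carrier_mat nx nx" and \<eta>: "\<eta> \<in> Theta nx nu ny nw H"
    and a: "a \<in> carrier_vec nx" and b: "b \<in> carrier_vec nx" and c: "c \<in> carrier_vec ny"
  defines "Q \<equiv> 2 * ((H *\<^sub>v a) \<bullet> (iE \<eta> *\<^sub>v a)) - wnorm2 (iP \<eta>) a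
      + 2 * ((H *\<^sub>v b) \<bullet> (iF \<eta> *\<^sub>v a)) + 2 * ((iC \<eta> *\<^sub>v a) \<bullet> c)
      + wnorm2 (iP \<eta>) b + wnorm2 (iSigma \<eta>) c"
  shows "Q \<ge> 0" "a \<noteq> 0\<^sub>v nx \<Longrightarrow> Q > 0"
proof -
  define E F C P \<Sigma> where "E = iE \<eta>" and "F = iF \<eta>" and "C = iC \<eta>" and "P = iP \<eta>" and "\<Sigma> = iSigma \<eta>"
  define M where "M =
      ((H\<^sup>T * E + E\<^sup>T * H - P) @\<^sub>c F\<^sup>T * H @\<^sub>c C\<^sup>T)
        @\<^sub>r (H\<^sup>T * F @\<^sub>c P @\<^sub>c 0\<^sub>m nx ny)
        @\<^sub>r (C @\<^sub>c 0\<^sub>m ny nx @\<^sub>c \<Sigma>)"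
  have E: "E \<in> carrier_mat nx nx" and F: "F \<in> carrier_mat nx nx" and C: "C \<in> carrier_mat ny nx"
    and P: "P \<in> carrier_mat nx nx" and \<Sigma>: "\<Sigma> \<in> carrier_mat ny ny"
    using \<eta> by (auto simp: Theta_def implicit_models_def pos_def_def E_def F_def C_def P_def \<Sigma>_def)
  \<comment> \<open>The dimension is reassociated to match the right-nested appends.\<close>
  have M: "pos_def (nx + (nx + ny)) M"
    using \<eta> by (simp add: Theta_def M_def E_def F_def C_def P_def \<Sigma>_def add.assoc)
  define v where "v = a @\<^sub>v (b @\<^sub>v c)"
  have bc: "b @\<^sub>v c \<in> carrier_vec (nx + ny)" using b c by simp
  have v: "v \<in> carrier_vec (nx + (nx + ny))" using a bc by (simp add: v_def)
  define R1 R2 R3 where "R1 = ((H\<^sup>T * E + E\<^sup>T * H - P) *\<^sub>v a + ((F\<^sup>T * H) *\<^sub>v b + C\<^sup>T *\<^sub>v c))"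
    and "R2 = (H\<^sup>T * F) *\<^sub>v a + (P *\<^sub>v b + 0\<^sub>m nx ny *\<^sub>v c)"
    and "R3 = C *\<^sub>v a + (0\<^sub>m ny nx *\<^sub>v b + \<Sigma> *\<^sub>v c)"
  have M11: "H\<^sup>T * E + E\<^sup>T * H - P \<in> carrier_mat nx nx"
    using H E P by auto
  have row1: "(H\<^sup>T * E + E\<^sup>T * H - P) @\<^sub>c F\<^sup>T * H @\<^sub>c C\<^sup>T \<in> carrier_mat nx (nx + (nx + ny))"
    and row2: "H\<^sup>T * F @\<^sub>c P @\<^sub>c 0\<^sub>m nx ny \<in> carrier_mat nx (nx + (nx + ny))"
    and row3: "C @\<^sub>c 0\<^sub>m ny nx @\<^sub>c \<Sigma> \<in> carrier_mat ny (nx + (nx + ny))"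
    using H E F C P \<Sigma> by (auto intro!: append_cols_carrier)
  have act: "(A @\<^sub>c B @\<^sub>c D) *\<^sub>v v = A *\<^sub>v a + (B *\<^sub>v b + D *\<^sub>v c)"
    if "A \<in> carrier_mat k nx" "B \<in> carrier_mat k nx" "D \<in> carrier_mat k ny" for A B D k
    using append_cols_mult_vec[OF that(1) append_cols_carrier[OF that(2,3)] a bc]
      append_cols_mult_vec[OF that(2,3) b c] by (simp add: v_def)
  have "M *\<^sub>v v = R1 @\<^sub>v (R2 @\<^sub>v R3)"
    unfolding M_def R1_def R2_def R3_def
    using mat_mult_append[OF row1 carrier_append_rows[OF row2 row3] v] mat_mult_append[OF row2 row3 v]
      act[OF M11, of "F\<^sup>T * H" "C\<^sup>T"] act[of "H\<^sup>T * F" nx P "0\<^sub>m nx ny"]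
      act[of C ny "0\<^sub>m ny nx" \<Sigma>] H E F C P \<Sigma>
    by simp
  moreover have R: "R1 \<in> carrier_vec nx" "R2 \<in> carrier_vec nx" "R3 \<in> carrier_vec ny"
    unfolding R1_def R2_def R3_def by (rule carrier_vecI; use F C \<Sigma> in simp)+
  ultimately have form: "v \<bullet> (M *\<^sub>v v) = a \<bullet> R1 + (b \<bullet> R2 + c \<bullet> R3)"
    using scalar_prod_append[OF a bc R(1), of "R2 @\<^sub>v R3"] scalar_prod_append[OF b c R(2,3)]
    by (simp add: v_def)
  have Ha: "H *\<^sub>v a \<in> carrier_vec nx" and Hb: "H *\<^sub>v b \<in> carrier_vec nx"
    and Ea: "E *\<^sub>v a \<in> carrier_vec nx" and Fa: "F *\<^sub>v a \<in> carrier_vec nx"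
    and Pa: "P *\<^sub>v a \<in> carrier_vec nx" and Pb: "P *\<^sub>v b \<in> carrier_vec nx"
    and Ca: "C *\<^sub>v a \<in> carrier_vec ny" and \<Sigma>c: "\<Sigma> *\<^sub>v c \<in> carrier_vec ny"
    using H E F C P \<Sigma> a b c by auto
  have tr: "A\<^sup>T *\<^sub>v z \<in> carrier_vec k" if "A \<in> carrier_mat l k" for A :: "real mat" and z k l
    by (rule carrier_vecI) (use that in simp)
  have "R1 = H\<^sup>T *\<^sub>v (E *\<^sub>v a) + E\<^sup>T *\<^sub>v (H *\<^sub>v a) - P *\<^sub>v a + (F\<^sup>T *\<^sub>v (H *\<^sub>v b) + C\<^sup>T *\<^sub>v c)"
    unfolding R1_def using H E F P a b
    by (simp add: minus_mult_distrib_mat_vec[of _ nx nx] add_mult_distrib_mat_vec[of _ nx nx]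
        assoc_mult_mat_vec[of _ nx nx _ nx])
  then have "a \<bullet> R1 = 2 * ((H *\<^sub>v a) \<bullet> (E *\<^sub>v a)) - wnorm2 P a + (H *\<^sub>v b) \<bullet> (F *\<^sub>v a) + (C *\<^sub>v a) \<bullet> c"
    using tr[OF H] tr[OF E] tr[OF F] tr[OF C] Pa comm_scalar_prod[OF Ha Ea] comm_scalar_prod[OF Hb Fa]
      inner_mat_vec_transpose[OF H a Ea] inner_mat_vec_transpose[OF E a Ha]
      inner_mat_vec_transpose[OF F a Hb] inner_mat_vec_transpose[OF C a c]
    by (simp add: scalar_prod_add_distrib[OF a] scalar_prod_minus_distrib[OF a] wnorm2_def)
  moreover have "R2 = H\<^sup>T *\<^sub>v (F *\<^sub>v a) + P *\<^sub>v b"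
    unfolding R2_def using H F P a b c
    by (auto intro!: eq_vecI simp: assoc_mult_mat_vec[of _ nx nx _ nx])
  then have "b \<bullet> R2 = (H *\<^sub>v b) \<bullet> (F *\<^sub>v a) + wnorm2 P b"
    using tr[OF H] Pb inner_mat_vec_transpose[OF H b Fa]
    by (simp add: scalar_prod_add_distrib[OF b] wnorm2_def)
  moreover have "R3 = C *\<^sub>v a + \<Sigma> *\<^sub>v c"
    unfolding R3_def using C \<Sigma> a b c by (auto intro!: eq_vecI)
  then have "c \<bullet> R3 = (C *\<^sub>v a) \<bullet> c + wnorm2 \<Sigma> c"
    using Ca \<Sigma>c comm_scalar_prod[OF c Ca] by (simp add: scalar_prod_add_distrib[OF c] wnorm2_def)
  ultimately have Q: "v \<bullet> (M *\<^sub>v v) = Q"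
    using form by (simp add: Q_def E_def F_def C_def P_def \<Sigma>_def)
  show "Q \<ge> 0" using pos_def_nonneg[OF M v] Q by simp
  show "Q > 0" if "a \<noteq> 0\<^sub>v nx"
  proof -
    have "v \<noteq> 0\<^sub>v (nx + (nx + ny))"
    proof
      assume v0: "v = 0\<^sub>v (nx + (nx + ny))"
      have "a $ i = 0" if "i < nx" for i
        using arg_cong[OF v0, of "\<lambda>v. v $ i"] that a by (simp add: v_def)
      with a have "a = 0\<^sub>v nx" by (auto intro!: eq_vecI)
      with \<open>a \<noteq> 0\<^sub>v nx\<close> show False by simp
    qed
    with M v Q show ?thesis by (auto simp: pos_def_def)
  qed
qed

text \<open>At the vector with blocks \<open>a\<close>, 0, 0 the form is
  \<open>2 * ((H a) \<bullet> (E a))\<close> minus the \<open>P\<close>-square of \<open>a\<close>.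
  If \<open>E\<close> annihilates a nonzero \<open>a\<close>, strict positivity makes that square
  negative, contradicting definiteness of \<open>P\<close>.\<close>

lemma Theta_E_kernel:
  assumes H: "H \<in> carrier_mat nx nx" and \<eta>: "\<eta> \<in> Theta nx nu ny nw H"
    and a: "a \<in> carrier_vec nx" and "iE \<eta> *\<^sub>v a = 0\<^sub>v nx"
  shows "a = 0\<^sub>v nx"
proof (rule ccontr)
  have P: "pos_def nx (iP \<eta>)" and car: "iF \<eta> \<in> carrier_mat nx nx" "iC \<eta> \<in> carrier_mat ny nx"
    "iP \<eta> \<in> carrier_mat nx nx" "iSigma \<eta> \<in> carrier_mat ny ny"
    using \<eta> by (auto simp: Theta_def implicit_models_def pos_def_def)
  have zero: "A *\<^sub>v 0\<^sub>v n = 0\<^sub>v m" if "A \<in> carrier_mat m n" for A :: "real mat" and m n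
    using that by (auto intro!: eq_vecI)
  assume "a \<noteq> 0\<^sub>v nx"
  with Theta_quadratic_form(2)[OF H \<eta> a, of "0\<^sub>v nx" "0\<^sub>v ny"]
  have "wnorm2 (iP \<eta>) a < 0"
    using assms car zero[OF H] zero[OF car(3)] zero[OF car(4)] by (simp add: wnorm2_def)
  with pos_def_nonneg[OF P a] show False by (simp add: wnorm2_def)
qed

text \<open>The quadratic form of \<open>\<Theta>\<close> at \<open>(a, -b, -\<Sigma>\<^sub>v\<inverse>Ca)\<close>: choosing the last block optimally is
  the Schur complement of \<open>\<Sigma>\<^sub>v\<close>.\<close>

lemma Theta_dissipation:
  assumes H: "H \<in> carrier_mat nx nx" and \<eta>: "\<eta> \<in> Theta nx nu ny nw H"
    and a: "a \<in> carrier_vec nx" and b: "b \<in> carrier_vec nx"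
  shows "wnorm2 (mat_inv (iSigma \<eta>)) (iC \<eta> *\<^sub>v a) - 2 * ((H *\<^sub>v a) \<bullet> (iE \<eta> *\<^sub>v a))
      + 2 * ((H *\<^sub>v b) \<bullet> (iF \<eta> *\<^sub>v a)) \<le> wnorm2 (iP \<eta>) b - wnorm2 (iP \<eta>) a"
proof -
  define S where "S = mat_inv (iSigma \<eta>)"
  have F: "iF \<eta> \<in> carrier_mat nx nx" and C: "iC \<eta> \<in> carrier_mat ny nx"
    and P: "iP \<eta> \<in> carrier_mat nx nx" and \<Sigma>: "iSigma \<eta> \<in> carrier_mat ny ny"
    and \<Sigma>pd: "pos_def ny (iSigma \<eta>)"
    using \<eta> by (auto simp: Theta_def implicit_models_def pos_def_def)
  have S: "S \<in> carrier_mat ny ny" "iSigma \<eta> * S = 1\<^sub>m ny"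
    using mat_inv_inverts[OF \<Sigma> pos_def_kernel[OF \<Sigma>pd]] by (auto simp: S_def)
  define z where "z = iC \<eta> *\<^sub>v a"
  have z: "z \<in> carrier_vec ny" and Sz: "S *\<^sub>v z \<in> carrier_vec ny" using C S a by (auto simp: z_def)
  have Hb: "H *\<^sub>v b \<in> carrier_vec nx" and Fa: "iF \<eta> *\<^sub>v a \<in> carrier_vec nx"
    and Pb: "iP \<eta> *\<^sub>v b \<in> carrier_vec nx" using H F P a b by auto
  have neg: "A *\<^sub>v (- x) = - (A *\<^sub>v x)" if "A \<in> carrier_mat k n" "x \<in> carrier_vec n"
    for A :: "real mat" and x k n
    using that by (auto intro!: eq_vecI)
  have "iSigma \<eta> *\<^sub>v (S *\<^sub>v z) = z"
    using S \<Sigma> z by (simp flip: assoc_mult_mat_vec)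
  then have "wnorm2 (iSigma \<eta>) (- (S *\<^sub>v z)) = z \<bullet> (S *\<^sub>v z)"
    using neg[OF \<Sigma> Sz] z Sz S(1) comm_scalar_prod[OF Sz z] by (simp add: wnorm2_def)
  moreover have "wnorm2 (iP \<eta>) (- b) = wnorm2 (iP \<eta>) b"
    using neg[OF P b] Pb b P by (simp add: wnorm2_def)
  moreover have "(H *\<^sub>v (- b)) \<bullet> (iF \<eta> *\<^sub>v a) = - ((H *\<^sub>v b) \<bullet> (iF \<eta> *\<^sub>v a))"
    using neg[OF H b] Hb Fa H F by simp
  moreover have "z \<bullet> - (S *\<^sub>v z) = - (z \<bullet> (S *\<^sub>v z))"
    using z Sz S by simp
  \<comment> \<open>With last block \<open>- (S z)\<close>, the \<Sigma> term contributes one copy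
    of \<open>z \<bullet> (S z)\<close> and the cross term minus two, leaving the output error with
    a minus sign. The sign of \<open>- b\<close> reproduces the minus in front of \<open>F\<close>
    in \<open>Fbar\<close>.\<close>
  ultimately show ?thesis
    using Theta_quadratic_form(1)[OF H \<eta> a, of "- b" "- (S *\<^sub>v z)"] b Sz
    by (simp add: wnorm2_def S_def z_def)
qed

text \<open>Each summand pairs \<open>q\<close> at \<open>t\<close> with the coupling to
  \<open>t - 1\<close>, one index away from the pairing in \<open>step\<close>. The bound therefore
  carries the pending \<open>q (d T)\<close> beside the storage \<open>p (d T)\<close>: the next use
  of \<open>step\<close> consumes both and turns them into storage at \<open>Suc T\<close>, while a
  new \<open>q\<close> becomes pending.\<close>

lemma dissipation_sum:
  fixes q p :: "'a \<Rightarrow> real" and r :: "'a \<Rightarrow> 'a \<Rightarrow> real"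
  assumes step: "\<And>t. t < T \<Longrightarrow> q (d t) + r (d t) (d (Suc t)) \<le> p (d (Suc t)) - p (d t)"
    and base: "q (d 0) + p (d 0) \<ge> 0"
  shows "(\<Sum>t = 1..T. q (d t) + r (d (t - 1)) (d t)) \<le> q (d T) + p (d T)"
  using step
proof (induction T)
  case (Suc T)
  then have "(\<Sum>t = 1..T. q (d t) + r (d (t - 1)) (d t)) \<le> q (d T) + p (d T)" by simp
  with Suc.prems[of T] show ?case by simp
qed (use base in simp)

section \<open>Nonsingular lifted dynamics and the simulated trajectory\<close>

lemma stack_zeroD:
  assumes "stack T n x = 0\<^sub>v (T * n)" "is_signal T n x" "t \<in> {1..T}"
  shows "x t = 0\<^sub>v n"
proof (rule eq_vecI)
  have "x t \<in> carrier_vec n" using assms by (blast intro: is_signalD)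
  then show "dim_vec (x t) = dim_vec (0\<^sub>v n)" by simp
  fix k assume "k < dim_vec (0\<^sub>v n :: real vec)"
  then have k: "k < n" by simp
  obtain s where t: "t = Suc s" "s < T" using assms(3) by (cases t) auto
  have "s * n + k < Suc s * n" using k by simp
  also have "\<dots> \<le> T * n" using t by (intro mult_right_mono) auto
  finally show "x t $ k = 0\<^sub>v n $ k"
    using stack_index[OF t(2) k, of x] assms(1) t k by simp
qed

lemma dynamics_blocks_signal:
  fixes E F :: "real mat"
  assumes E: "E \<in> carrier_mat n n" and F: "F \<in> carrier_mat n n"
  shows "is_signal T n (\<lambda>t. if t = 1 then E *\<^sub>v x 1 else E *\<^sub>v x t - F *\<^sub>v x (t - 1))"
  unfolding is_signal_def
proof
  fix t
  show "(if t = 1 then E *\<^sub>v x 1 else E *\<^sub>v x t - F *\<^sub>v x (t - 1)) \<in> carrier_vec n"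
    by (rule carrier_vecI) (use E F in simp)
qed

text \<open>Forward substitution: once the previous state is known to vanish, the next block row
  says that \<open>E\<close> annihilates the current one.\<close>

lemma Fbar_kernel:
  assumes E: "iE \<eta> \<in> carrier_mat n n" and F: "iF \<eta> \<in> carrier_mat n n"
    and inj: "\<And>a. a \<in> carrier_vec n \<Longrightarrow> iE \<eta> *\<^sub>v a = 0\<^sub>v n \<Longrightarrow> a = 0\<^sub>v n"
    and v: "v \<in> carrier_vec (T * n)" and Fv: "Fbar T n \<eta> *\<^sub>v v = 0\<^sub>v (T * n)"
  shows "v = 0\<^sub>v (T * n)"
proof -
  obtain x where x: "is_signal T n x" and xv: "stack T n x = v"
    using exists_signal_stack[OF v] .
  let ?z = "\<lambda>t. if t = 1 then iE \<eta> *\<^sub>v x 1 else iE \<eta> *\<^sub>v x t - iF \<eta> *\<^sub>v x (t - 1)"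
  note z = dynamics_blocks_signal[OF E F, of T x]
  have z0: "?z t = 0\<^sub>v n" if "t \<in> {1..T}" for t
    using stack_zeroD[OF _ z that] Fbar_mult_stack[OF E F x] Fv xv by simp
  have "x t = 0\<^sub>v n" if "t \<in> {1..T}" for t
    using that
  proof (induction t)
    \<comment> \<open>The claim at time 0 is vacuous, so the first block row appears here as the
      case \<open>t = 0\<close>, without a predecessor.\<close>
    case (Suc t)
    have xc: "x (Suc t) \<in> carrier_vec n" using x Suc.prems by (rule is_signalD)
    have "iE \<eta> *\<^sub>v x (Suc t) = 0\<^sub>v n"
    proof (cases "t = 0")
      case False
      then have "x t = 0\<^sub>v n" using Suc by simp
      moreover have "iF \<eta> *\<^sub>v 0\<^sub>v n = 0\<^sub>v n" using F by (auto intro!: eq_vecI)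
      moreover have "iE \<eta> *\<^sub>v x (Suc t) - 0\<^sub>v n = iE \<eta> *\<^sub>v x (Suc t)"
        using E xc by (auto intro!: eq_vecI)
      ultimately show ?thesis using z0[OF Suc.prems] False by simp
    qed (use z0[OF Suc.prems] in simp)
    then show ?case by (rule inj[OF xc])
  qed simp
  then have "stack T n x = stack T n (\<lambda>_. 0\<^sub>v n)" by (intro stack_cong)
  also have "\<dots> = 0\<^sub>v (T * n)"
  proof (rule eq_vecI, goal_cases)
    case (1 i)
    then have "n > 0" by (cases n) auto
    then show ?case using 1 by (simp add: stack_def)
  qed (simp add: stack_def)
  finally show ?thesis using xv by simp
qed

lemma sim_is_signal:
  assumes A: "eA \<gamma> \<in> carrier_mat nx nx" and B: "eB \<gamma> \<in> carrier_mat nx nu"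
    and G: "eG \<gamma> \<in> carrier_mat nx nw" and u: "is_signal T nu u" and w: "is_signal T nw w"
    and \<xi>: "\<xi> \<in> carrier_vec nx"
  shows "is_signal T nx (sim \<gamma> u w \<xi>)"
proof -
  have "sim \<gamma> u w \<xi> t \<in> carrier_vec nx" if "t \<le> T" for t
    using that
  proof (induction t)
    case (Suc t)
    show ?case
    proof (cases t)
      case (Suc s)
      then have "u t \<in> carrier_vec nu" "w t \<in> carrier_vec nw"
        using u w \<open>Suc t \<le> T\<close> by (auto intro: is_signalD)
      then show ?thesis using Suc Suc.IH \<open>Suc t \<le> T\<close> A B G by simp
    qed (use \<xi> in simp)
  qed (use \<xi> in simp)
  then show ?thesis by (simp add: is_signal_def)
qed

text \<open>Multiplying the explicit recursion by \<open>E\<close> restores the implicit one, so the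
  simulated trajectory satisfies the lifted constraint exactly.\<close>

lemma Fbar_mult_sim:
  assumes \<eta>: "\<eta> \<in> implicit_models nx nu ny nw"
    and Ei: "mat_inv (iE \<eta>) \<in> carrier_mat nx nx" "iE \<eta> * mat_inv (iE \<eta>) = 1\<^sub>m nx"
    and u: "is_signal T nu u" and w: "is_signal T nw w" and \<xi>: "\<xi> \<in> carrier_vec nx"
  shows "is_signal T nx (sim (explicit_of \<eta>) u w \<xi>)"
    and "Fbar T nx \<eta> *\<^sub>v stack T nx (sim (explicit_of \<eta>) u w \<xi>) = eps T nx \<eta> u w \<xi>"
proof -
  have E: "iE \<eta> \<in> carrier_mat nx nx" and F: "iF \<eta> \<in> carrier_mat nx nx"
    and K: "iK \<eta> \<in> carrier_mat nx nu" and L: "iL \<eta> \<in> carrier_mat nx nw"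
    using \<eta> by (auto simp: implicit_models_def)
  show x: "is_signal T nx (sim (explicit_of \<eta>) u w \<xi>)"
    using sim_is_signal[of "explicit_of \<eta>" nx nu nw T u w \<xi>] Ei F K L u w \<xi>
    by (simp add: explicit_of_def)
  have cancel: "iE \<eta> *\<^sub>v ((mat_inv (iE \<eta>) * M) *\<^sub>v v) = M *\<^sub>v v"
    if M: "M \<in> carrier_mat nx m" and v: "v \<in> carrier_vec m" for M v m
  proof -
    have Mv: "M *\<^sub>v v \<in> carrier_vec nx" using M v by simp
    have "(mat_inv (iE \<eta>) * M) *\<^sub>v v = mat_inv (iE \<eta>) *\<^sub>v (M *\<^sub>v v)"
      using Ei(1) M v by (rule assoc_mult_mat_vec)
    then show ?thesis
      using assoc_mult_mat_vec[OF E Ei(1) Mv] Ei(2) Mv by simp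
  qed
  show "Fbar T nx \<eta> *\<^sub>v stack T nx (sim (explicit_of \<eta>) u w \<xi>) = eps T nx \<eta> u w \<xi>"
    unfolding Fbar_mult_stack[OF E F x] eps_def
  proof (rule stack_cong, goal_cases)
    case (1 t)
    show ?case
    proof (cases "t = 1")
      case False
      define s where "s = t - 2"
      have t: "t = Suc (Suc s)" using False 1 by (auto simp: s_def)
      let ?x = "sim (explicit_of \<eta>) u w \<xi> (Suc s)"
      have xc: "?x \<in> carrier_vec nx" using x 1 t by (auto intro: is_signalD)
      have uc: "u (Suc s) \<in> carrier_vec nu" using u 1 t by (auto intro: is_signalD)
      have wc: "w (Suc s) \<in> carrier_vec nw" using w 1 t by (auto intro: is_signalD)
      have "iE \<eta> *\<^sub>v sim (explicit_of \<eta>) u w \<xi> t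
          = iF \<eta> *\<^sub>v ?x + iK \<eta> *\<^sub>v u (Suc s) + iL \<eta> *\<^sub>v w (Suc s)"
        using E F K L Ei(1) xc uc wc cancel[OF F xc] cancel[OF K uc] cancel[OF L wc]
        by (simp add: t explicit_of_def mult_add_distrib_mat_vec[of _ nx nx])
      then show ?thesis
        using t F K L xc uc wc by (auto intro!: eq_vecI)
    qed simp
  qed
qed

section \<open>From time steps to lifted quantities\<close>

text \<open>The lifted residual subtracts the input part before the state part, which isolates a
  vector independent of the states, as the expansion requires.\<close>

lemma output_error_lifted:
  assumes C: "C \<in> carrier_mat ny nx" and D: "D \<in> carrier_mat ny nu" and S: "S \<in> carrier_mat ny ny"
    and x: "is_signal T nx x" and u: "is_signal T nu u" and y: "is_signal T ny y"
  shows "(\<Sum>t = 1..T. wnorm2 S (y t - C *\<^sub>v x t - D *\<^sub>v u t))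
    = wnorm2 (1\<^sub>m T \<otimes>\<^sub>K S)
        (stack T ny y - (1\<^sub>m T \<otimes>\<^sub>K D) *\<^sub>v stack T nu u - (1\<^sub>m T \<otimes>\<^sub>K C) *\<^sub>v stack T nx x)"
proof -
  have Cx: "is_signal T ny (\<lambda>t. C *\<^sub>v x t)" and Du: "is_signal T ny (\<lambda>t. D *\<^sub>v u t)"
    using C D x u by (auto simp: is_signal_def)
  let ?r = "\<lambda>t. y t - D *\<^sub>v u t - C *\<^sub>v x t"
  have r0: "is_signal T ny (\<lambda>t. y t - D *\<^sub>v u t)" using y Du by (auto simp: is_signal_def)
  have r: "is_signal T ny ?r" using r0 Cx by (auto simp: is_signal_def)
  have "stack T ny y - (1\<^sub>m T \<otimes>\<^sub>K D) *\<^sub>v stack T nu u - (1\<^sub>m T \<otimes>\<^sub>K C) *\<^sub>v stack T nx x = stack T ny ?r"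
    unfolding block_diagonal_mult_stack[OF C x] block_diagonal_mult_stack[OF D u]
    by (simp only: stack_minus[OF y Du] stack_minus[OF r0 Cx])
  moreover have "wnorm2 (1\<^sub>m T \<otimes>\<^sub>K S) (stack T ny ?r) = (\<Sum>t = 1..T. wnorm2 S (?r t))"
    using S r unfolding wnorm2_def block_diagonal_mult_stack[OF S r]
    by (intro stack_inner) (auto simp: is_signal_def)
  moreover have "y t - C *\<^sub>v x t - D *\<^sub>v u t = ?r t" if "t \<in> {1..T}" for t
    using is_signalD[OF y that] is_signalD[OF Cx that] is_signalD[OF Du that] C D
    by (auto intro!: eq_vecI)
  ultimately show ?thesis by simp
qed

text \<open>In the paper's notation, \<open>\<delta>'\<Psi>\<delta> \<le> 0\<close>.\<close>

lemma lifted_dissipation: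
  assumes H: "H \<in> carrier_mat nx nx" and \<eta>: "\<eta> \<in> Theta nx nu ny nw H"
    and v: "v \<in> carrier_vec (T * nx)"
  shows "wnorm2 (1\<^sub>m T \<otimes>\<^sub>K mat_inv (iSigma \<eta>)) ((1\<^sub>m T \<otimes>\<^sub>K iC \<eta>) *\<^sub>v v)
    - 2 * (((1\<^sub>m T \<otimes>\<^sub>K H) *\<^sub>v v) \<bullet> (Fbar T nx \<eta> *\<^sub>v v)) \<le> 0"
proof -
  have E: "iE \<eta> \<in> carrier_mat nx nx" and F: "iF \<eta> \<in> carrier_mat nx nx"
    and C: "iC \<eta> \<in> carrier_mat ny nx" and P: "iP \<eta> \<in> carrier_mat nx nx"
    and \<Sigma>: "iSigma \<eta> \<in> carrier_mat ny ny" and \<Sigma>pd: "pos_def ny (iSigma \<eta>)"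
    using \<eta> by (auto simp: Theta_def implicit_models_def pos_def_def)
  define S where "S = mat_inv (iSigma \<eta>)"
  have S: "S \<in> carrier_mat ny ny"
    using mat_inv_inverts[OF \<Sigma> pos_def_kernel[OF \<Sigma>pd]] by (auto simp: S_def)
  obtain x where x: "is_signal T nx x" and xv: "stack T nx x = v"
    using exists_signal_stack[OF v] .
  \<comment> \<open>The added zero state at time 0 gives the first block row the same shape as the
    others, since \<open>F\<close> maps it to zero, and it makes the base case of the telescoping
    trivial.\<close>
  define d where "d t = (if t = 0 then 0\<^sub>v nx else x t)" for t
  have d: "is_signal T nx d" and dv: "stack T nx d = v" and d0: "d 0 = 0\<^sub>v nx"
    using x by (auto simp: is_signal_def d_def xv[symmetric] intro!: stack_cong)
  have dc: "d t \<in> carrier_vec nx" if "t \<le> T" for t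
    using that d d0 by (cases "t = 0") (auto simp: is_signal_def)
  have zero: "A *\<^sub>v 0\<^sub>v n = 0\<^sub>v m" if "A \<in> carrier_mat m n" for A :: "real mat" and m n
    using that by (auto intro!: eq_vecI)
  let ?z = "\<lambda>t. if t = 1 then iE \<eta> *\<^sub>v d 1 else iE \<eta> *\<^sub>v d t - iF \<eta> *\<^sub>v d (t - 1)"
  note z = dynamics_blocks_signal[OF E F, of T d]
  define q where "q a = wnorm2 S (iC \<eta> *\<^sub>v a) - 2 * ((H *\<^sub>v a) \<bullet> (iE \<eta> *\<^sub>v a))" for a
  define r where "r a b = 2 * ((H *\<^sub>v b) \<bullet> (iF \<eta> *\<^sub>v a))" for a b
  have diss: "q a + r a b \<le> wnorm2 (iP \<eta>) b - wnorm2 (iP \<eta>) a"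
    if "a \<in> carrier_vec nx" "b \<in> carrier_vec nx" for a b
    using Theta_dissipation[OF H \<eta> that] by (simp add: q_def r_def S_def)
  have Cd: "is_signal T ny (\<lambda>t. iC \<eta> *\<^sub>v d t)" using d C by (auto simp: is_signal_def)
  have outputs: "wnorm2 (1\<^sub>m T \<otimes>\<^sub>K S) ((1\<^sub>m T \<otimes>\<^sub>K iC \<eta>) *\<^sub>v v) = (\<Sum>t = 1..T. wnorm2 S (iC \<eta> *\<^sub>v d t))"
    unfolding wnorm2_def dv[symmetric] block_diagonal_mult_stack[OF C d] block_diagonal_mult_stack[OF S Cd]
    using S Cd by (intro stack_inner) (auto simp: is_signal_def)
  have "((1\<^sub>m T \<otimes>\<^sub>K H) *\<^sub>v v) \<bullet> (Fbar T nx \<eta> *\<^sub>v v) = (\<Sum>t = 1..T. (H *\<^sub>v d t) \<bullet> ?z t)"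
    unfolding dv[symmetric] block_diagonal_mult_stack[OF H d] Fbar_mult_stack[OF E F d]
    by (rule stack_inner[OF z])
  also have "\<dots> = (\<Sum>t = 1..T. (H *\<^sub>v d t) \<bullet> (iE \<eta> *\<^sub>v d t) - (H *\<^sub>v d t) \<bullet> (iF \<eta> *\<^sub>v d (t - 1)))"
  proof (rule sum.cong[OF refl])
    fix t assume that: "t \<in> {1..T}"
    have c: "H *\<^sub>v d t \<in> carrier_vec nx" "iE \<eta> *\<^sub>v d t \<in> carrier_vec nx"
      "iF \<eta> *\<^sub>v d (t - 1) \<in> carrier_vec nx"
      using dc[of t] dc[of "t - 1"] that H E F by auto
    show "(H *\<^sub>v d t) \<bullet> ?z t = (H *\<^sub>v d t) \<bullet> (iE \<eta> *\<^sub>v d t) - (H *\<^sub>v d t) \<bullet> (iF \<eta> *\<^sub>v d (t - 1))"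
      using scalar_prod_minus_distrib[OF c] c zero[OF F] d0 by (cases "t = 1") auto
  qed
  finally have inner: "((1\<^sub>m T \<otimes>\<^sub>K H) *\<^sub>v v) \<bullet> (Fbar T nx \<eta> *\<^sub>v v)
    = (\<Sum>t = 1..T. (H *\<^sub>v d t) \<bullet> (iE \<eta> *\<^sub>v d t) - (H *\<^sub>v d t) \<bullet> (iF \<eta> *\<^sub>v d (t - 1)))" .
  have "wnorm2 (1\<^sub>m T \<otimes>\<^sub>K S) ((1\<^sub>m T \<otimes>\<^sub>K iC \<eta>) *\<^sub>v v)
      - 2 * (((1\<^sub>m T \<otimes>\<^sub>K H) *\<^sub>v v) \<bullet> (Fbar T nx \<eta> *\<^sub>v v))
      = (\<Sum>t = 1..T. q (d t) + r (d (t - 1)) (d t))"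
    unfolding outputs inner
    by (simp add: q_def r_def sum_distrib_left sum_subtractf sum.distrib algebra_simps)
  also have "\<dots> \<le> q (d T) + wnorm2 (iP \<eta>) (d T)"
  proof (rule dissipation_sum)
    show "0 \<le> q (d 0) + wnorm2 (iP \<eta>) (d 0)"
      by (simp add: q_def d0 wnorm2_def zero[OF H] zero[OF E] zero[OF C] zero[OF S] zero[OF P])
  qed (use dc in \<open>auto intro: diss\<close>)
  \<comment> \<open>One more use of the dissipation inequality, with successor state 0, absorbs the
    pending cost and the storage at time \<open>T\<close>.\<close>
  also have "\<dots> \<le> 0"
    using diss[of "d T" "0\<^sub>v nx"] dc[of T] zero[OF H] zero[OF P] F by (simp add: r_def wnorm2_def)
  finally show ?thesis by (simp add: S_def)
qed

section \<open>Tightness of the relaxation\<close>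

theorem lemma8:
  fixes T nx nu ny nw :: nat
    and H :: "real mat"
    and \<eta> :: implicit_model
    and \<gamma> :: explicit_model
    and u y w :: signal
    and \<xi> Y U Xs h :: "real vec"
    and \<Lambda> Cb Db \<Sigma>Y Fb \<Psi> :: "real mat"
    and mul :: "signal \<Rightarrow> real vec"
  assumes "T \<ge> 1"
    and "H \<in> carrier_mat nx nx"
    and "vec_space.rank nx H = nx"
    and "\<eta> \<in> Theta nx nu ny nw H"
    and "is_signal T nu u"
    and "is_signal T ny y"
    and "is_signal T nw w"
    and "\<xi> \<in> carrier_vec nx"
    and \<gamma>: "\<gamma> = explicit_of \<eta>"
    and \<Lambda>: "\<Lambda> = 1\<^sub>m T \<otimes>\<^sub>K H"
    and Cb: "Cb = 1\<^sub>m T \<otimes>\<^sub>K iC \<eta>"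
    and Db: "Db = 1\<^sub>m T \<otimes>\<^sub>K iD \<eta>"
    and \<Sigma>Y: "\<Sigma>Y = 1\<^sub>m T \<otimes>\<^sub>K iSigma \<eta>"
    and Fb: "Fb = Fbar T nx \<eta>"
    and Y: "Y = stack T ny y"
    and U: "U = stack T nu u"
    and Xs: "Xs = stack T nx (sim \<gamma> u w \<xi>)"
    and \<Psi>: "\<Psi> = Cb\<^sup>T * mat_inv \<Sigma>Y * Cb - \<Lambda>\<^sup>T * Fb - Fb\<^sup>T * \<Lambda>"
    and h: "h = mat_inv (Fb\<^sup>T) *\<^sub>v
              (\<Psi> *\<^sub>v Xs - (Cb\<^sup>T * mat_inv \<Sigma>Y) *\<^sub>v (Y - Db *\<^sub>v U) + \<Lambda>\<^sup>T *\<^sub>v eps T nx \<eta> u w \<xi>)"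
    and mul: "mul = (\<lambda>x. 2 \<cdot>\<^sub>v (\<Lambda> *\<^sub>v stack T nx x + h))"
  shows "Jbar T nx u y w \<xi> mul \<eta> = ereal (sim_error T u y w \<xi> \<gamma>)"
proof -
  note H = assms(2) and \<eta> = assms(4) and u = assms(5) and y = assms(6) and w = assms(7) and \<xi> = assms(8)
  have E: "iE \<eta> \<in> carrier_mat nx nx" and F: "iF \<eta> \<in> carrier_mat nx nx"
    and C: "iC \<eta> \<in> carrier_mat ny nx" and D: "iD \<eta> \<in> carrier_mat ny nu"
    and \<Sigma>: "iSigma \<eta> \<in> carrier_mat ny ny" and \<Sigma>pd: "pos_def ny (iSigma \<eta>)"
    and im: "\<eta> \<in> implicit_models nx nu ny nw"
    using \<eta> by (auto simp: Theta_def implicit_models_def pos_def_def)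
  define S where "S = mat_inv (iSigma \<eta>)"
  have S: "S \<in> carrier_mat ny ny" "S * iSigma \<eta> = 1\<^sub>m ny" "S\<^sup>T = S"
    using mat_inv_inverts[OF \<Sigma> pos_def_kernel[OF \<Sigma>pd]] pos_def_mat_inv_sym[OF \<Sigma>pd]
    by (auto simp: S_def)
  have SY: "mat_inv \<Sigma>Y = 1\<^sub>m T \<otimes>\<^sub>K S"
    unfolding \<Sigma>Y by (rule mat_inv_block_diagonal[OF \<Sigma> S(1,2)])
  have SYc: "mat_inv \<Sigma>Y \<in> carrier_mat (T * ny) (T * ny)"
    unfolding SY using S by (intro kronecker_carrier) auto
  have SYs: "(mat_inv \<Sigma>Y)\<^sup>T = mat_inv \<Sigma>Y"
    by (simp add: SY kronecker_transpose S(3))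
  have Cbc: "Cb \<in> carrier_mat (T * ny) (T * nx)" and Dbc: "Db \<in> carrier_mat (T * ny) (T * nu)"
    and \<Lambda>c: "\<Lambda> \<in> carrier_mat (T * nx) (T * nx)" and Fbc: "Fb \<in> carrier_mat (T * nx) (T * nx)"
    unfolding Cb Db \<Lambda> Fb using C D H by (auto intro!: kronecker_carrier)
  note Ei = mat_inv_inverts[OF E Theta_E_kernel[OF H \<eta>]]
  have xs: "is_signal T nx (sim \<gamma> u w \<xi>)" and Xs_dyn: "Fb *\<^sub>v Xs = eps T nx \<eta> u w \<xi>"
    unfolding \<gamma> Xs Fb by (simp_all only: Fbar_mult_sim[OF im Ei(1,2) u w \<xi>])
  have Xsc: "Xs \<in> carrier_vec (T * nx)" by (simp add: Xs)
  have ec: "eps T nx \<eta> u w \<xi> \<in> carrier_vec (T * nx)" by (simp add: eps_def)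
  define R where "R = Y - Db *\<^sub>v U"
  have Rc: "R \<in> carrier_vec (T * ny)" using Dbc by (auto simp: R_def Y U)
  have FbTc: "Fb\<^sup>T \<in> carrier_mat (T * nx) (T * nx)" using Fbc by simp
  \<comment> \<open>Forward substitution gives the kernel of \<open>Fb\<close>, while
    \<open>h\<close> involves the inverse of its transpose; equality of determinants transfers
    nonsingularity.\<close>
  have "det Fb \<noteq> 0"
    using Fbar_kernel[OF E F Theta_E_kernel[OF H \<eta>]] det_0_iff_vec_prod_zero[OF Fbc] Fb by blast
  then have "v = 0\<^sub>v (T * nx)" if "v \<in> carrier_vec (T * nx)" "Fb\<^sup>T *\<^sub>v v = 0\<^sub>v (T * nx)" for v
    using det_0_iff_vec_prod_zero[OF FbTc] det_transpose[OF Fbc] that by auto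
  note FbTi = mat_inv_inverts[OF FbTc this]
  define g where "g = \<Psi> *\<^sub>v Xs - (Cb\<^sup>T * mat_inv \<Sigma>Y) *\<^sub>v R + \<Lambda>\<^sup>T *\<^sub>v eps T nx \<eta> u w \<xi>"
  have gc: "g \<in> carrier_vec (T * nx)"
    by (rule carrier_vecI) (use \<Lambda>c in \<open>simp add: g_def\<close>)
  have hg: "h = mat_inv (Fb\<^sup>T) *\<^sub>v g" by (simp add: h g_def R_def)
  have hc: "h \<in> carrier_vec (T * nx)" using FbTi(1) gc hg by simp
  \<comment> \<open>Undoing the inverse turns the definition of \<open>h\<close> into the
    stationarity condition at \<open>Xs\<close>.\<close>
  have Fh: "Fb\<^sup>T *\<^sub>v h = g"
    using assoc_mult_mat_vec[OF FbTc FbTi(1) gc] FbTi(2) gc by (simp add: hg)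
  define f where "f x = (\<Sum>t = 1..T. wnorm2 (mat_inv (iSigma \<eta>)) (y t - iC \<eta> *\<^sub>v x t - iD \<eta> *\<^sub>v u t))
        - mul x \<bullet> dyn_constraint T nx \<eta> u \<xi> x w" for x
  have errors: "(\<Sum>t = 1..T. wnorm2 (mat_inv (iSigma \<eta>)) (y t - iC \<eta> *\<^sub>v x t - iD \<eta> *\<^sub>v u t))
      = wnorm2 (mat_inv \<Sigma>Y) (R - Cb *\<^sub>v stack T nx x)" if "is_signal T nx x" for x
    unfolding SY R_def Y U Cb Db
    using output_error_lifted[OF C D S(1) that u y] unfolding S_def .
  have f_le: "f x \<le> wnorm2 (mat_inv \<Sigma>Y) (R - Cb *\<^sub>v Xs)" if x: "is_signal T nx x" for x
  proof -
    define \<delta> where "\<delta> = stack T nx x - Xs"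
    have "f x = wnorm2 (mat_inv \<Sigma>Y) (R - Cb *\<^sub>v stack T nx x)
        - (2 \<cdot>\<^sub>v (\<Lambda> *\<^sub>v stack T nx x + h)) \<bullet> (Fb *\<^sub>v stack T nx x - eps T nx \<eta> u w \<xi>)"
      unfolding f_def errors[OF x] mul dyn_constraint_def Fb ..
    also have "\<dots> = wnorm2 (mat_inv \<Sigma>Y) (R - Cb *\<^sub>v Xs)
        + (wnorm2 (mat_inv \<Sigma>Y) (Cb *\<^sub>v \<delta>) - 2 * ((\<Lambda> *\<^sub>v \<delta>) \<bullet> (Fb *\<^sub>v \<delta>)))"
      by (rule relaxed_objective_expansion[OF Cbc SYc SYs Fbc \<Lambda>c Rc hc stack_carrier Xsc Xs_dyn _ \<delta>_def])
        (simp add: Fh g_def \<Psi>)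
    also have "\<dots> \<le> wnorm2 (mat_inv \<Sigma>Y) (R - Cb *\<^sub>v Xs)"
      using lifted_dissipation[OF H \<eta>, of \<delta> T] Xsc by (simp add: \<delta>_def SY S_def Cb \<Lambda> Fb)
    finally show ?thesis .
  qed
  \<comment> \<open>At the simulated trajectory the constraint residual is zero, so the multiplier
    drops out and the upper bound on \<open>f\<close> is attained.\<close>
  have "dyn_constraint T nx \<eta> u \<xi> (sim \<gamma> u w \<xi>) w = 0\<^sub>v (T * nx)"
    using Xs_dyn ec by (simp add: dyn_constraint_def Fb Xs)
  moreover have "mul (sim \<gamma> u w \<xi>) \<in> carrier_vec (T * nx)"
    using \<Lambda>c hc by (simp add: mul)
  ultimately have f_sim: "f (sim \<gamma> u w \<xi>) = wnorm2 (mat_inv \<Sigma>Y) (R - Cb *\<^sub>v Xs)"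
    unfolding f_def errors[OF xs] by (simp add: Xs)
  have err: "sim_error T u y w \<xi> \<gamma> = wnorm2 (mat_inv \<Sigma>Y) (R - Cb *\<^sub>v Xs)"
    using errors[OF xs] by (simp add: sim_error_def Xs \<gamma> explicit_of_def)
  have "Jbar T nx u y w \<xi> mul \<eta> = (SUP x \<in> {x. is_signal T nx x}. ereal (f x))"
    by (simp add: Jbar_def f_def)
  also have "\<dots> = ereal (sim_error T u y w \<xi> \<gamma>)"
  proof (rule antisym)
    show "(SUP x \<in> {x. is_signal T nx x}. ereal (f x)) \<le> ereal (sim_error T u y w \<xi> \<gamma>)"
      using f_le by (intro SUP_least) (simp add: err)
    show "ereal (sim_error T u y w \<xi> \<gamma>) \<le> (SUP x \<in> {x. is_signal T nx x}. ereal (f x))"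
      using xs by (intro SUP_upper2[of "sim \<gamma> u w \<xi>"]) (simp_all add: err f_sim)
  qed
  finally show ?thesis .
qed

end
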